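(* The heavy-ball method does not accelerate on the classes $(\mathcal F_{\mu,L})_{0<\mu<L}$. More precisely, there exists an absolute constant $C>0$ such that for all $0<\mu<L$, with $\kappa=\mu/L$, and for all $(\gamma,\beta)\in\mathbb R\times\mathbb R$, the worst-case asymptotic convergence rate of $\mathrm{HB}_{\gamma,\beta}$ over $\mathcal F_{\mu,L}$ satisfies $$\rho_{\gamma,\beta}(\mathcal F_{\mu,L})\ \ge\ \frac{1-C\kappa}{1+C\kappa};$$ that is, the best rate over all choices of $(\gamma,\beta)\in\mathbb R\times\mathbb R$ is at least $\frac{1-C\kappa}{1+C\kappa}$.
   Context: For $0<\mu\le L$, $\mathcal F_{\mu,L}$ is the set of continuously differentiable functions $f:\mathbb R^d\to\mathbb R$ ($d\ge1$ arbitrary; the class contains functions of all finite dimensions) with $f(x)\le f(y)+\langle\nabla f(y),x-y\rangle+\frac L2\|x-y\|^2$ and $f(x)\ge f(y)+\langle\nabla f(y),x-y\rangle+\frac\mu2\|x-y\|^2$ for all $x,y\in\mathbb R^d$. For $\gamma,\beta\in\mathbb R$ and differentiable $f$, the heavy-ball method $\mathrm{HB}_{\gamma,\beta}(f)$ is the iteration $x_{t+1}=x_t-\gamma\nabla f(x_t)+\beta(x_t-x_{t-1})$, $t\ge1$, from initial points $x_0,x_1$. $\mathrm{HB}_{\gamma,\beta}$ has worst-case asymptotic rate $\rho\ge0$ over a class $\mathcal F$ if for all $\varepsilon>0$ there is $T_0$ such that for all $f\in\mathcal F$ (with minimizer $x_\star$), all initial points $x_0,x_1$ and all $T\ge T_0$,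 $\|x_T-x_\star\|\le(\rho+\varepsilon)^T\big(\|x_0-x_\star\|^2+\|x_1-x_\star\|^2\big)^{1/2}$. $\rho_{\gamma,\beta}(\mathcal F)$ denotes the smallest such $\rho$ ($+\infty$ if none exists). *)

theory Defs
  imports "HOL-Analysis.Analysis"
begin

text \<open>
  The rate of a method over the class is uniform in the functions and hence in their dimension,
  so all the spaces of dimension \<open>d\<close> have to live in one type. They are realised as the
  coordinate subspaces of the inner product space of finitely supported real sequences.
\<close>

typedef finseq = "{x :: nat \<Rightarrow> real. finite {i. x i \<noteq> 0}}"
  morphisms coord Abs_finseq
  by (intro exI[of _ "\<lambda>_. 0"]) simp

setup_lifting type_definition_finseq

lemma finite_support [simp]: "finite {i. coord x i \<noteq> 0}"
  using coord[of x] by simp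

lemma finseq_eqI: "(\<And>i. coord x i = coord y i) \<Longrightarrow> x = y"
  by (simp add: coord_inject[symmetric] fun_eq_iff)

instantiation finseq :: real_vector
begin

lift_definition zero_finseq :: finseq is "\<lambda>_. 0" by simp

lift_definition plus_finseq :: "finseq \<Rightarrow> finseq \<Rightarrow> finseq" is "\<lambda>x y i. x i + y i"
  subgoal for x y by (rule finite_subset[of _ "{i. x i \<noteq> 0} \<union> {i. y i \<noteq> 0}"]) auto
  done

lift_definition uminus_finseq :: "finseq \<Rightarrow> finseq" is "\<lambda>x i. - x i" by simp

lift_definition minus_finseq :: "finseq \<Rightarrow> finseq \<Rightarrow> finseq" is "\<lambda>x y i. x i - y i"
  subgoal for x y by (rule finite_subset[of _ "{i. x i \<noteq> 0} \<union> {i. y i \<noteq> 0}"]) auto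
  done

lift_definition scaleR_finseq :: "real \<Rightarrow> finseq \<Rightarrow> finseq" is "\<lambda>c x i. c * x i"
  by (erule finite_subset[rotated]) auto

instance
  by standard (transfer; simp add: algebra_simps fun_eq_iff)+

end

lemma coord_simps [simp]:
  "coord 0 i = 0"
  "coord (x + y) i = coord x i + coord y i"
  "coord (- x) i = - coord x i"
  "coord (x - y) i = coord x i - coord y i"
  "coord (c *\<^sub>R x) i = c * coord x i"
  by (transfer; simp)+

instantiation finseq :: real_inner
begin

definition inner_finseq :: "finseq \<Rightarrow> finseq \<Rightarrow> real" where
  "inner_finseq x y = (\<Sum>i | coord x i \<noteq> 0. coord x i * coord y i)"

definition norm_finseq :: "finseq \<Rightarrow> real" where
  "norm_finseq x = sqrt (inner x x)"

definition dist_finseq :: "finseq \<Rightarrow> finseq \<Rightarrow> real" where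
  "dist_finseq x y = norm (x - y)"

definition sgn_finseq :: "finseq \<Rightarrow> finseq" where
  "sgn_finseq x = x /\<^sub>R norm x"

definition uniformity_finseq :: "(finseq \<times> finseq) filter" where
  "uniformity_finseq = (INF e\<in>{0<..}. principal {(x, y). dist x y < e})"

definition open_finseq :: "finseq set \<Rightarrow> bool" where
  "open_finseq U \<longleftrightarrow> (\<forall>x\<in>U. eventually (\<lambda>(x', y). x' = x \<longrightarrow> y \<in> U) uniformity)"

lemma inner_finseq_superset:
  assumes "finite A" "\<And>i. i \<notin> A \<Longrightarrow> coord x i = 0 \<or> coord y i = 0"
  shows "inner x y = (\<Sum>i\<in>A. coord x i * coord y i)"
proof -
  have "inner x y = (\<Sum>i\<in>A \<union> {i. coord x i \<noteq> 0}. coord x i * coord y i)"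
    unfolding inner_finseq_def by (rule sum.mono_neutral_left) (use assms in auto)
  also have "\<dots> = (\<Sum>i\<in>A. coord x i * coord y i)"
    by (rule sum.mono_neutral_right) (use assms in auto)
  finally show ?thesis .
qed

instance
proof
  fix x y z :: finseq and r :: real
  show "inner x y = inner y x"
    by (subst (1 2) inner_finseq_superset[of "{i. coord x i \<noteq> 0} \<union> {i. coord y i \<noteq> 0}"])
      (auto simp: mult.commute)
  show "inner (x + y) z = inner x z + inner y z"
    by (subst (1 2 3) inner_finseq_superset[of "{i. coord z i \<noteq> 0}"])
      (auto simp: algebra_simps sum.distrib)
  show "inner (r *\<^sub>R x) y = r * inner x y"
    by (subst (1 2) inner_finseq_superset[of "{i. coord y i \<noteq> 0}"])
      (auto simp: algebra_simps sum_distrib_left)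
  show "0 \<le> inner x x"
    by (simp add: inner_finseq_def sum_nonneg)
  show "(inner x x = 0) = (x = 0)"
    by (auto simp: inner_finseq_def sum_nonneg_eq_0_iff intro: finseq_eqI)
qed (simp_all add: norm_finseq_def dist_finseq_def sgn_finseq_def uniformity_finseq_def
       open_finseq_def)

end

definition Rd :: "nat \<Rightarrow> finseq set" where
  "Rd d = {x. \<forall>i\<ge>d. coord x i = 0}"

lemma subspace_Rd: "subspace (Rd d)"
  by (auto simp: subspace_def Rd_def)

lemma inner_Rd: "x \<in> Rd d \<Longrightarrow> inner x y = (\<Sum>i<d. coord x i * coord y i)"
  by (rule inner_finseq_superset) (auto simp: Rd_def)

lemma norm_Rd: "x \<in> Rd d \<Longrightarrow> norm x = sqrt (\<Sum>i<d. (coord x i)\<^sup>2)"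
  by (simp add: norm_eq_sqrt_inner inner_Rd power2_eq_square)

lemma coord_image_Rd: "coord ` Rd d = {x. \<forall>i\<ge>d. x i = 0}"
proof
  show "{x. \<forall>i\<ge>d. x i = 0} \<subseteq> coord ` Rd d"
  proof
    fix x :: "nat \<Rightarrow> real" assume x: "x \<in> {x. \<forall>i\<ge>d. x i = 0}"
    then have "{i. x i \<noteq> 0} \<subseteq> {..<d}" by (auto simp: not_le[symmetric])
    then have "coord (Abs_finseq x) = x"
      by (intro Abs_finseq_inverse) (auto intro: finite_subset)
    with x show "x \<in> coord ` Rd d" by (intro image_eqI[of _ _ "Abs_finseq x"]) (auto simp: Rd_def)
  qed
qed (auto simp: Rd_def)

text \<open>
  A function on the \<open>d\<close>-dimensional space is a function on \<^typ>\<open>finseq\<close> of which only the values on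
  \<^term>\<open>Rd d\<close> matter; the gradient is the one within \<^term>\<open>Rd d\<close>.
\<close>

definition has_gradient :: "nat \<Rightarrow> (finseq \<Rightarrow> real) \<Rightarrow> finseq \<Rightarrow> finseq \<Rightarrow> bool" where
  "has_gradient d f g x \<longleftrightarrow> g \<in> Rd d \<and> (f has_derivative (\<lambda>h. inner g h)) (at x within Rd d)"

definition grad :: "nat \<Rightarrow> (finseq \<Rightarrow> real) \<Rightarrow> finseq \<Rightarrow> finseq" where
  "grad d f x = (THE g. has_gradient d f g x)"

lemma has_gradient_unique:
  assumes x: "x \<in> Rd d" and g: "has_gradient d f g x" and g': "has_gradient d f g' x"
  shows "g = g'"
proof -
  define v where "v = g - g'"
  have v: "v \<in> Rd d"
    using g g' unfolding v_def has_gradient_def by (auto intro: subspace_diff[OF subspace_Rd])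
  have dir: "((\<lambda>t. f (x + t *\<^sub>R v)) has_derivative (\<lambda>t. inner k (t *\<^sub>R v))) (at (0::real))"
    if "has_gradient d f k x" for k
  proof -
    have "((\<lambda>t::real. x + t *\<^sub>R v) has_derivative (\<lambda>t. t *\<^sub>R v)) (at 0)"
      by (auto intro!: derivative_eq_intros)
    moreover have "(f has_derivative (\<lambda>h. inner k h))
        (at (x + 0 *\<^sub>R v) within (\<lambda>t. x + t *\<^sub>R v) ` (UNIV :: real set))"
      using that x v unfolding has_gradient_def
      by (auto intro!: subspace_add[OF subspace_Rd] subspace_scale[OF subspace_Rd]
               elim!: has_derivative_subset)
    ultimately show ?thesis
      by (rule has_derivative_in_compose)
  qed
  have "(\<lambda>t::real. inner g (t *\<^sub>R v)) = (\<lambda>t. inner g' (t *\<^sub>R v))"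
    by (rule has_derivative_unique[OF dir[OF g] dir[OF g']])
  from fun_cong[OF this, of 1] have "inner v v = 0"
    by (simp add: v_def inner_diff_left)
  then show ?thesis
    by (simp add: v_def)
qed

lemma grad_eqI: "x \<in> Rd d \<Longrightarrow> has_gradient d f g x \<Longrightarrow> grad d f x = g"
  unfolding grad_def by (blast intro: has_gradient_unique)

definition continuously_differentiable_Rd :: "nat \<Rightarrow> (finseq \<Rightarrow> real) \<Rightarrow> bool" where
  "continuously_differentiable_Rd d f \<longleftrightarrow>
     (\<forall>x\<in>Rd d. \<exists>g. has_gradient d f g x) \<and> continuous_on (Rd d) (grad d f)"

text \<open>The pairs record the dimension together with the function.\<close>

definition smooth_strongly_convex :: "real \<Rightarrow> real \<Rightarrow> (nat \<times> (finseq \<Rightarrow> real)) set" where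
  "smooth_strongly_convex \<mu> L =
     {(d, f). d \<ge> 1 \<and> continuously_differentiable_Rd d f \<and>
        (\<forall>x\<in>Rd d. \<forall>y\<in>Rd d.
           f x \<le> f y + inner (grad d f y) (x - y) + L / 2 * (norm (x - y))\<^sup>2 \<and>
           f x \<ge> f y + inner (grad d f y) (x - y) + \<mu> / 2 * (norm (x - y))\<^sup>2)}"

fun heavy_ball ::
  "real \<Rightarrow> real \<Rightarrow> nat \<Rightarrow> (finseq \<Rightarrow> real) \<Rightarrow> finseq \<Rightarrow> finseq \<Rightarrow> nat \<Rightarrow> finseq" where
  "heavy_ball \<gamma> \<beta> d f x0 x1 0 = x0"
| "heavy_ball \<gamma> \<beta> d f x0 x1 (Suc 0) = x1"
| "heavy_ball \<gamma> \<beta> d f x0 x1 (Suc (Suc t)) =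
     heavy_ball \<gamma> \<beta> d f x0 x1 (Suc t)
     - \<gamma> *\<^sub>R grad d f (heavy_ball \<gamma> \<beta> d f x0 x1 (Suc t))
     + \<beta> *\<^sub>R (heavy_ball \<gamma> \<beta> d f x0 x1 (Suc t) - heavy_ball \<gamma> \<beta> d f x0 x1 t)"

definition has_asymptotic_rate ::
  "real \<Rightarrow> real \<Rightarrow> (nat \<times> (finseq \<Rightarrow> real)) set \<Rightarrow> real \<Rightarrow> bool" where
  "has_asymptotic_rate \<gamma> \<beta> F \<rho> \<longleftrightarrow>
     \<rho> \<ge> 0 \<and>
     (\<forall>\<epsilon>>0. \<exists>T0. \<forall>(d, f)\<in>F. \<forall>xs. is_arg_min f (\<lambda>x. x \<in> Rd d) xs \<longrightarrow>
        (\<forall>x0\<in>Rd d. \<forall>x1\<in>Rd d. \<forall>T\<ge>T0.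
           norm (heavy_ball \<gamma> \<beta> d f x0 x1 T - xs)
             \<le> (\<rho> + \<epsilon>) ^ T * sqrt ((norm (x0 - xs))\<^sup>2 + (norm (x1 - xs))\<^sup>2)))"

text \<open>
  The infimum over the empty set is \<^term>\<open>\<infinity> :: ereal\<close>. Otherwise the infimum is attained, so that
  it is the smallest rate.
\<close>

definition worst_case_rate :: "real \<Rightarrow> real \<Rightarrow> (nat \<times> (finseq \<Rightarrow> real)) set \<Rightarrow> ereal" where
  "worst_case_rate \<gamma> \<beta> F = (INF \<rho>\<in>{\<rho>. has_asymptotic_rate \<gamma> \<beta> F \<rho>}. ereal \<rho>)"

lemma worst_case_rate_attained:
  assumes "has_asymptotic_rate \<gamma> \<beta> F \<rho>0"
  shows "\<exists>\<rho>. has_asymptotic_rate \<gamma> \<beta> F \<rho> \<and> worst_case_rate \<gamma> \<beta> F = ereal \<rho>"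
proof -
  define S where "S = {\<rho>. has_asymptotic_rate \<gamma> \<beta> F \<rho>}"
  have S: "S \<noteq> {}" "bdd_below S" and nonneg: "\<And>\<rho>. \<rho> \<in> S \<Longrightarrow> 0 \<le> \<rho>"
    using assms by (auto simp: S_def has_asymptotic_rate_def intro!: bdd_belowI[of _ 0])
  have "has_asymptotic_rate \<gamma> \<beta> F (Inf S)"
    unfolding has_asymptotic_rate_def
  proof (intro conjI allI impI)
    show "Inf S \<ge> 0"
      using S nonneg by (intro cInf_greatest) auto
    fix \<epsilon> :: real assume "\<epsilon> > 0"
    then obtain \<rho> where \<rho>: "\<rho> \<in> S" "\<rho> < Inf S + \<epsilon>"
      using cInf_lessD[OF S(1), of "Inf S + \<epsilon>"] by auto
    define \<delta> where "\<delta> = Inf S + \<epsilon> - \<rho>"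
    have "\<delta> > 0" and eq: "\<rho> + \<delta> = Inf S + \<epsilon>"
      using \<rho> by (auto simp: \<delta>_def)
    have "has_asymptotic_rate \<gamma> \<beta> F \<rho>"
      using \<rho>(1) by (simp add: S_def)
    from this[unfolded has_asymptotic_rate_def, THEN conjunct2, rule_format, OF \<open>\<delta> > 0\<close>]
    show "\<exists>T0. \<forall>(d, f)\<in>F. \<forall>xs. is_arg_min f (\<lambda>x. x \<in> Rd d) xs \<longrightarrow>
        (\<forall>x0\<in>Rd d. \<forall>x1\<in>Rd d. \<forall>T\<ge>T0.
           norm (heavy_ball \<gamma> \<beta> d f x0 x1 T - xs)
             \<le> (Inf S + \<epsilon>) ^ T * sqrt ((norm (x0 - xs))\<^sup>2 + (norm (x1 - xs))\<^sup>2))"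
      unfolding eq .
  qed
  moreover have "worst_case_rate \<gamma> \<beta> F = ereal (Inf S)"
    unfolding worst_case_rate_def S_def[symmetric]
  proof (rule antisym)
    show "(INF \<rho>\<in>S. ereal \<rho>) \<le> ereal (Inf S)"
      using calculation by (intro INF_lower) (simp add: S_def)
    show "ereal (Inf S) \<le> (INF \<rho>\<in>S. ereal \<rho>)"
      using S by (intro INF_greatest) (auto intro: cInf_lower)
  qed
  ultimately show ?thesis by blast
qed

end

theory Submission
  imports Defs
begin

text \<open>
  A rate \<open>\<rho> < 1 - 100 \<kappa>\<close> on the quadratics \<open>\<lambda>\<parallel>\<cdot>\<parallel>\<^sup>2/2\<close> already forces \<open>0 < \<gamma> L < 2 (1 + \<beta>)\<close> and makes
  \<open>1 - \<beta>\<close> and \<open>\<kappa>\<close> small multiples of \<open>\<gamma> L\<close>. For such parameters some function of the class has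
  the vertices \<open>w\<^sup>t\<close> of a regular \<open>K\<close>-gon in the plane as a heavy-ball orbit, which does not converge.
  The recurrence prescribes the gradient at \<open>w\<^sup>t\<close> as \<open>L R w\<^sup>t\<close> with
  \<open>\<gamma> L R = 1 + \<beta> - w - \<beta> / w\<close>. Subtracting \<open>\<mu> w\<^sup>t\<close> leaves \<open>(L - \<mu>) m w\<^sup>t\<close>, and this is \<open>L - \<mu>\<close> times
  the projection of \<open>w\<^sup>t\<close> onto the polygon with vertices \<open>m w\<^sup>k\<close> as soon as
  \<open>Re m - |m|\<^sup>2 \<ge> |Im m| cot (\<pi> / K)\<close>. Here \<open>Im m\<close> is of the order of \<open>(1 - \<beta>) / (\<gamma> L)\<close>, hence small, and
  \<open>K\<close> can be chosen such that \<open>Re m\<close> stays away from \<open>0\<close> and \<open>1\<close>.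
\<close>

section \<open>The complex plane as the test space of dimension two\<close>

definition of_complex_finseq :: "complex \<Rightarrow> finseq" where
  "of_complex_finseq z = Abs_finseq (\<lambda>i. if i = 0 then Re z else if i = 1 then Im z else 0)"

definition to_complex :: "finseq \<Rightarrow> complex" where
  "to_complex x = Complex (coord x 0) (coord x 1)"

lemma coord_of_complex_finseq:
  "coord (of_complex_finseq z) i = (if i = 0 then Re z else if i = 1 then Im z else 0)"
proof -
  have "finite {i::nat. (if i = 0 then Re z else if i = 1 then Im z else 0) \<noteq> 0}"
    by (rule finite_subset[of _ "{0, 1}"]) (auto split: if_splits)
  then show ?thesis
    unfolding of_complex_finseq_def by (subst Abs_finseq_inverse) simp_all
qed

lemma to_complex_of_complex [simp]: "to_complex (of_complex_finseq z) = z"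
  by (simp add: to_complex_def coord_of_complex_finseq)

lemma of_complex_in_Rd [simp]: "of_complex_finseq z \<in> Rd 2"
  by (auto simp: Rd_def coord_of_complex_finseq)

lemma of_complex_to_complex: "x \<in> Rd 2 \<Longrightarrow> of_complex_finseq (to_complex x) = x"
  by (rule finseq_eqI) (auto simp: to_complex_def coord_of_complex_finseq Rd_def)

lemma of_complex_add: "of_complex_finseq (y + z) = of_complex_finseq y + of_complex_finseq z"
  and of_complex_diff: "of_complex_finseq (y - z) = of_complex_finseq y - of_complex_finseq z"
  and of_complex_scaleR: "of_complex_finseq (c *\<^sub>R z) = c *\<^sub>R of_complex_finseq z"
  by (auto intro!: finseq_eqI simp: coord_of_complex_finseq)

lemma to_complex_diff: "to_complex (x - y) = to_complex x - to_complex y"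
  by (simp add: to_complex_def complex_eq_iff)

lemma inner_of_complex: "inner (of_complex_finseq z) x = inner z (to_complex x)"
  unfolding inner_Rd[OF of_complex_in_Rd]
  by (simp add: coord_of_complex_finseq inner_complex_def to_complex_def numeral_2_eq_2)

lemma norm_of_complex [simp]: "norm (of_complex_finseq z) = norm z"
  by (simp add: norm_eq_sqrt_inner inner_of_complex)

lemma norm_to_complex: "x \<in> Rd 2 \<Longrightarrow> norm (to_complex x) = norm x"
  by (metis norm_of_complex of_complex_to_complex)

lemma has_gradientI_quadratic_bound:
  assumes "g \<in> Rd d" "x \<in> Rd d"
    and bd: "\<And>y. y \<in> Rd d \<Longrightarrow> \<bar>f y - f x - inner g (y - x)\<bar> \<le> M * (norm (y - x))\<^sup>2"
  shows "has_gradient d f g x"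
  unfolding has_gradient_def
proof (intro conjI has_derivativeI_sandwich[of 1])
  show "bounded_linear (inner g)"
    by (rule bounded_linear_inner_right)
  show "norm (f y - f x - inner g (y - x)) / norm (y - x) \<le> M * norm (y - x)"
    if "y \<in> Rd d" "y \<noteq> x" for y
    using bd[OF that(1)] that by (simp add: divide_simps power2_eq_square mult_ac)
  have "((\<lambda>y. M * norm (y - x)) \<longlongrightarrow> M * norm (x - x)) (at x within Rd d)"
    by (intro tendsto_intros)
  then show "((\<lambda>y. M * norm (y - x)) \<longlongrightarrow> 0) (at x within Rd d)"
    by simp
qed (use assms in auto)

text \<open>The two bounds squeeze the first-order remainder of \<open>F\<close> between 0 and a
  quadratic, so \<open>G\<close> is automatically the gradient and no derivative of \<open>F\<close>
  has to be computed.\<close>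

lemma
  fixes F :: "complex \<Rightarrow> real" and G :: "complex \<Rightarrow> complex"
  assumes "0 \<le> \<mu>" and G: "continuous_on UNIV G"
    and ub: "\<And>x y. F x \<le> F y + inner (G y) (x - y) + L / 2 * (norm (x - y))\<^sup>2"
    and lb: "\<And>x y. F x \<ge> F y + inner (G y) (x - y) + \<mu> / 2 * (norm (x - y))\<^sup>2"
  shows grad_to_complex: "x \<in> Rd 2 \<Longrightarrow>
      grad 2 (\<lambda>x. F (to_complex x)) x = of_complex_finseq (G (to_complex x))"
    and smooth_strongly_convex_to_complex:
      "(2, \<lambda>x. F (to_complex x)) \<in> smooth_strongly_convex \<mu> L"
proof -
  let ?f = "\<lambda>x. F (to_complex x)" and ?g = "\<lambda>x. of_complex_finseq (G (to_complex x))"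
  have ub': "?f x \<le> ?f y + inner (?g y) (x - y) + L / 2 * (norm (x - y))\<^sup>2"
    and lb': "?f x \<ge> ?f y + inner (?g y) (x - y) + \<mu> / 2 * (norm (x - y))\<^sup>2"
    if "x \<in> Rd 2" "y \<in> Rd 2" for x y
  proof -
    have "norm (x - y) = norm (to_complex x - to_complex y)"
      using that by (metis norm_to_complex subspace_Rd subspace_diff to_complex_diff)
    then show "?f x \<le> ?f y + inner (?g y) (x - y) + L / 2 * (norm (x - y))\<^sup>2"
      "?f x \<ge> ?f y + inner (?g y) (x - y) + \<mu> / 2 * (norm (x - y))\<^sup>2"
      using ub lb by (simp_all add: inner_of_complex to_complex_diff)
  qed
  have grad: "has_gradient 2 ?f (?g x) x" if "x \<in> Rd 2" for x
  proof (rule has_gradientI_quadratic_bound)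
    fix y assume "y \<in> Rd 2"
    with ub'[OF this that] lb'[OF this that] \<open>0 \<le> \<mu>\<close>
    show "\<bar>?f y - ?f x - inner (?g x) (y - x)\<bar> \<le> L / 2 * (norm (y - x))\<^sup>2"
      by (smt (verit) divide_nonneg_nonneg mult_nonneg_nonneg zero_le_power2)
  qed (use that in auto)
  show eq: "grad 2 ?f x = ?g x" if "x \<in> Rd 2" for x
    by (rule grad_eqI[OF that grad[OF that]])
  have "continuous_on (Rd 2) to_complex"
    unfolding continuous_on_iff dist_norm
    by (metis norm_to_complex subspace_Rd subspace_diff to_complex_diff)
  then have "continuous_on (Rd 2) (\<lambda>x. G (to_complex x))"
    by (rule continuous_on_compose2[OF G]) simp
  then have "continuous_on (Rd 2) ?g"
    unfolding continuous_on_iff dist_norm of_complex_diff[symmetric] norm_of_complex .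
  then have "continuous_on (Rd 2) (grad 2 ?f)"
    by (simp cong: continuous_on_cong add: eq)
  then show "(2, ?f) \<in> smooth_strongly_convex \<mu> L"
    using grad ub' lb' unfolding smooth_strongly_convex_def continuously_differentiable_Rd_def
    by (auto simp: eq)
qed

lemma heavy_ball_of_complex:
  assumes grad: "\<And>z. grad 2 f (of_complex_finseq z) = of_complex_finseq (G z)"
    and rec: "\<And>t. X (Suc (Suc t)) = X (Suc t) - \<gamma> *\<^sub>R G (X (Suc t)) + \<beta> *\<^sub>R (X (Suc t) - X t)"
  shows "heavy_ball \<gamma> \<beta> 2 f (of_complex_finseq (X 0)) (of_complex_finseq (X 1)) t
    = of_complex_finseq (X t)"
  by (induction t rule: induct_nat_012)
    (simp_all add: grad rec of_complex_add of_complex_diff of_complex_scaleR)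

text \<open>A sequence satisfying the recurrence is the orbit started at its own first two terms.
  Since \<open>G 0 = 0\<close>, the lower bound makes 0 a minimizer, so a rate controls
  \<open>norm (X T)\<close> itself.\<close>

lemma rate_bounds_complex_orbit:
  fixes F :: "complex \<Rightarrow> real" and G :: "complex \<Rightarrow> complex"
  assumes rate: "has_asymptotic_rate \<gamma> \<beta> (smooth_strongly_convex \<mu> L) \<rho>" and "0 < \<epsilon>"
    and "0 \<le> \<mu>" and G: "continuous_on UNIV G" "G 0 = 0"
    and ub: "\<And>x y. F x \<le> F y + inner (G y) (x - y) + L / 2 * (norm (x - y))\<^sup>2"
    and lb: "\<And>x y. F x \<ge> F y + inner (G y) (x - y) + \<mu> / 2 * (norm (x - y))\<^sup>2"
    and rec: "\<And>t. X (Suc (Suc t)) = X (Suc t) - \<gamma> *\<^sub>R G (X (Suc t)) + \<beta> *\<^sub>R (X (Suc t) - X t)"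
  shows "\<exists>T0. \<forall>T\<ge>T0. norm (X T) \<le> (\<rho> + \<epsilon>) ^ T * sqrt ((norm (X 0))\<^sup>2 + (norm (X 1))\<^sup>2)"
proof -
  let ?f = "\<lambda>x. F (to_complex x)"
  have zero: "of_complex_finseq 0 = 0"
    by (rule finseq_eqI) (simp add: coord_of_complex_finseq)
  obtain T0 where T0: "\<forall>(d, f)\<in>smooth_strongly_convex \<mu> L. \<forall>xs. is_arg_min f (\<lambda>x. x \<in> Rd d) xs \<longrightarrow>
        (\<forall>x0\<in>Rd d. \<forall>x1\<in>Rd d. \<forall>T\<ge>T0.
           norm (heavy_ball \<gamma> \<beta> d f x0 x1 T - xs)
             \<le> (\<rho> + \<epsilon>) ^ T * sqrt ((norm (x0 - xs))\<^sup>2 + (norm (x1 - xs))\<^sup>2))"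
    using rate \<open>0 < \<epsilon>\<close> unfolding has_asymptotic_rate_def by blast
  have "F 0 \<le> F z" for z
    using lb[where x = z and y = 0] \<open>0 \<le> \<mu>\<close> \<open>G 0 = 0\<close>
    by simp (smt (verit) divide_nonneg_nonneg mult_nonneg_nonneg zero_le_power2)
  then have argmin: "is_arg_min ?f (\<lambda>x. x \<in> Rd 2) 0"
    unfolding is_arg_min_def zero[symmetric] to_complex_of_complex by (auto simp: not_less)
  have hb: "heavy_ball \<gamma> \<beta> 2 ?f (of_complex_finseq (X 0)) (of_complex_finseq (X 1)) t
    = of_complex_finseq (X t)" for t
    by (rule heavy_ball_of_complex[of _ G])
      (use grad_to_complex[OF \<open>0 \<le> \<mu>\<close> G(1) ub lb] rec in simp_all)
  have "\<forall>T\<ge>T0. norm (heavy_ball \<gamma> \<beta> 2 ?f (of_complex_finseq (X 0)) (of_complex_finseq (X 1)) T - 0)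
      \<le> (\<rho> + \<epsilon>) ^ T * sqrt ((norm (of_complex_finseq (X 0) - 0))\<^sup>2 + (norm (of_complex_finseq (X 1) - 0))\<^sup>2)"
    using T0 smooth_strongly_convex_to_complex[OF \<open>0 \<le> \<mu>\<close> G(1) ub lb] argmin
      of_complex_in_Rd by blast
  then show ?thesis
    unfolding hb by auto
qed

section \<open>Constraints on the parameters from quadratic functions\<close>

lemma le_if_power_le_const_mult_power:
  fixes a b c :: real
  assumes "0 \<le> b" and le: "\<And>n. n \<ge> N \<Longrightarrow> a ^ n \<le> b ^ n * c"
  shows "a \<le> b"
proof (rule ccontr)
  assume "\<not> a \<le> b"
  then have "0 < a" and q: "b / a < 1" "0 \<le> b / a"
    using \<open>0 \<le> b\<close> by auto
  have "(\<lambda>n. (b / a) ^ n * c) \<longlonglongrightarrow> 0 * c"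
    by (intro tendsto_mult LIMSEQ_power_zero tendsto_const) (use q in simp)
  moreover have "\<forall>\<^sub>F n in sequentially. 1 \<le> (b / a) ^ n * c"
    using eventually_ge_at_top[of N]
    by eventually_elim (use le \<open>0 < a\<close> in \<open>simp add: power_divide field_simps\<close>)
  ultimately have "1 \<le> 0 * c"
    by (intro tendsto_lowerbound[of _ _ sequentially]) auto
  then show False by simp
qed

text \<open>On \<open>lam / 2 * (norm x)\<^sup>2\<close> the recurrence is linear with this
  characteristic equation, so the powers \<open>z ^ t\<close> form an orbit. As the plane is
  complex, non-real roots need no separate treatment.\<close>

lemma rate_ge_quadratic_root:
  fixes z :: complex
  assumes rate: "has_asymptotic_rate \<gamma> \<beta> (smooth_strongly_convex \<mu> L) \<rho>"
    and "0 \<le> \<mu>" "\<mu> \<le> lam" "lam \<le> L"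
    and z: "z\<^sup>2 = of_real (1 + \<beta> - \<gamma> * lam) * z - of_real \<beta>"
  shows "norm z \<le> \<rho>"
proof (rule field_le_epsilon)
  fix \<epsilon> :: real assume "\<epsilon> > 0"
  have "lam / 2 * (norm x)\<^sup>2 = lam / 2 * (norm y)\<^sup>2 + inner (lam *\<^sub>R y) (x - y) + lam / 2 * (norm (x - y))\<^sup>2"
    for x y :: complex
    by (simp add: power2_norm_eq_inner inner_diff algebra_simps inner_commute)
  moreover have "\<mu> / 2 * (norm u)\<^sup>2 \<le> lam / 2 * (norm u)\<^sup>2" "lam / 2 * (norm u)\<^sup>2 \<le> L / 2 * (norm u)\<^sup>2"
    for u :: complex
    using assms by (auto intro!: mult_right_mono)
  ultimately have bounds:
    "lam / 2 * (norm x)\<^sup>2 \<le> lam / 2 * (norm y)\<^sup>2 + inner (lam *\<^sub>R y) (x - y) + L / 2 * (norm (x - y))\<^sup>2"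
    "lam / 2 * (norm x)\<^sup>2 \<ge> lam / 2 * (norm y)\<^sup>2 + inner (lam *\<^sub>R y) (x - y) + \<mu> / 2 * (norm (x - y))\<^sup>2"
    for x y :: complex
    by (smt (verit))+
  have "z ^ Suc (Suc t) = z ^ Suc t - \<gamma> *\<^sub>R lam *\<^sub>R z ^ Suc t + \<beta> *\<^sub>R (z ^ Suc t - z ^ t)" for t
  proof -
    have "z ^ Suc (Suc t) = z ^ t * z\<^sup>2"
      by (simp add: power2_eq_square)
    also have "\<dots> = z ^ Suc t - \<gamma> *\<^sub>R lam *\<^sub>R z ^ Suc t + \<beta> *\<^sub>R (z ^ Suc t - z ^ t)"
      unfolding z by (simp add: scaleR_conv_of_real algebra_simps)
    finally show ?thesis .
  qed
  moreover have "continuous_on UNIV (\<lambda>z :: complex. lam *\<^sub>R z)"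
    by (intro continuous_intros)
  ultimately obtain T0 where T0: "\<forall>T\<ge>T0. norm (z ^ T)
      \<le> (\<rho> + \<epsilon>) ^ T * sqrt ((norm (z ^ 0))\<^sup>2 + (norm (z ^ 1))\<^sup>2)"
    using rate_bounds_complex_orbit[OF rate \<open>\<epsilon> > 0\<close> \<open>0 \<le> \<mu>\<close> _ scaleR_zero_right bounds, of "\<lambda>t. z ^ t"]
    by blast
  have "0 \<le> \<rho> + \<epsilon>"
    using rate \<open>\<epsilon> > 0\<close> by (simp add: has_asymptotic_rate_def)
  then show "norm z \<le> \<rho> + \<epsilon>"
    using T0[unfolded norm_power, rule_format] by (rule le_if_power_le_const_mult_power)
qed

text \<open>A monic quadratic that is nonpositive at \<open>s\<close> has a real root at or beyond
  \<open>s\<close>. The second claim is the first one after reflecting \<open>z\<close> to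
  \<open>- z\<close>.\<close>

lemma quadratic_pos_if_roots_bounded:
  fixes a b \<rho> s :: real
  assumes "\<And>z. z\<^sup>2 = a * z - b \<Longrightarrow> \<bar>z\<bar> \<le> \<rho>" and "\<rho> < s"
  shows "s\<^sup>2 - a * s + b > 0" "s\<^sup>2 + a * s + b > 0"
proof -
  have pos: "s\<^sup>2 - c * s + b > 0" if roots: "\<And>z. z\<^sup>2 = c * z - b \<Longrightarrow> \<bar>z\<bar> \<le> \<rho>" for c
  proof (rule ccontr)
    assume "\<not> s\<^sup>2 - c * s + b > 0"
    then have neg: "s\<^sup>2 - c * s + b \<le> 0" by simp
    define z where "z = (c + sqrt (c\<^sup>2 - 4 * b)) / 2"
    have "(2 * s - c)\<^sup>2 \<le> c\<^sup>2 - 4 * b"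
      using neg by (simp add: power2_eq_square algebra_simps)
    then have "2 * s - c \<le> sqrt (c\<^sup>2 - 4 * b)" "0 \<le> c\<^sup>2 - 4 * b"
      using real_le_rsqrt order_trans[OF zero_le_power2] by blast+
    then have "s \<le> z" "z\<^sup>2 = c * z - b"
      by (simp_all add: z_def power2_eq_square field_simps)
    then show False
      using roots[of z] \<open>\<rho> < s\<close> by linarith
  qed
  show "s\<^sup>2 - a * s + b > 0"
    by (rule pos) (rule assms)
  have "\<bar>z\<bar> \<le> \<rho>" if "z\<^sup>2 = (- a) * z - b" for z
    using assms(1)[of "- z"] that by simp
  from pos[of "- a", OF this] show "s\<^sup>2 + a * s + b > 0" by simp
qed

lemma complex_quadratic_factors:
  fixes a b :: complex
  shows "\<exists>z w. z\<^sup>2 = a * z - b \<and> w\<^sup>2 = a * w - b \<and> z * w = b"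
proof (intro exI conjI)
  define s where "s = csqrt (a\<^sup>2 - 4 * b)"
  have b: "b = (a * a - s * s) / 4"
    using power2_csqrt[of "a\<^sup>2 - 4 * b"] by (simp add: s_def power2_eq_square)
  show "((a + s) / 2)\<^sup>2 = a * ((a + s) / 2) - b" "((a - s) / 2)\<^sup>2 = a * ((a - s) / 2) - b"
    "(a + s) / 2 * ((a - s) / 2) = b"
    unfolding b by (simp_all add: power2_eq_square field_simps)
qed

context
  fixes \<gamma> \<beta> \<mu> L \<rho> :: real
  assumes rate: "has_asymptotic_rate \<gamma> \<beta> (smooth_strongly_convex \<mu> L) \<rho>"
    and muL: "0 < \<mu>" "\<mu> \<le> L"
begin

lemma rate_nonneg: "0 \<le> \<rho>"
  using rate by (simp add: has_asymptotic_rate_def)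

text \<open>Signs at a point replace a case distinction between real and complex roots, and they
  give inequalities that are linear in \<open>\<beta>\<close> and \<open>\<gamma>\<close>.\<close>

lemma characteristic_polynomial_pos:
  assumes "\<rho> < s" "\<mu> \<le> lam" "lam \<le> L"
  shows "s\<^sup>2 - (1 + \<beta> - \<gamma> * lam) * s + \<beta> > 0" "s\<^sup>2 + (1 + \<beta> - \<gamma> * lam) * s + \<beta> > 0"
proof -
  have "\<bar>z\<bar> \<le> \<rho>" if "z\<^sup>2 = (1 + \<beta> - \<gamma> * lam) * z - \<beta>" for z
  proof -
    have "(of_real z :: complex)\<^sup>2 = of_real (1 + \<beta> - \<gamma> * lam) * of_real z - of_real \<beta>"
      by (simp flip: of_real_power of_real_mult of_real_diff add: that)
    from rate_ge_quadratic_root[OF rate _ _ _ this] assms muL show ?thesis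
      by simp
  qed
  from quadratic_pos_if_roots_bounded[OF this \<open>\<rho> < s\<close>]
  show "s\<^sup>2 - (1 + \<beta> - \<gamma> * lam) * s + \<beta> > 0" "s\<^sup>2 + (1 + \<beta> - \<gamma> * lam) * s + \<beta> > 0"
    by auto
qed

text \<open>\<open>\<beta>\<close> is the product of the two characteristic roots, both of modulus
  at most \<open>\<rho>\<close>.\<close>

lemma abs_momentum_le: "\<bar>\<beta>\<bar> \<le> \<rho>\<^sup>2"
proof -
  obtain z w :: complex where "z\<^sup>2 = of_real (1 + \<beta> - \<gamma> * \<mu>) * z - of_real \<beta>"
    "w\<^sup>2 = of_real (1 + \<beta> - \<gamma> * \<mu>) * w - of_real \<beta>" and zw: "z * w = of_real \<beta>"
    using complex_quadratic_factors by blast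
  then have "norm z \<le> \<rho>" "norm w \<le> \<rho>"
    using rate_ge_quadratic_root[OF rate] muL by auto
  then have "norm (z * w) \<le> \<rho> * \<rho>"
    unfolding norm_mult by (intro mult_mono) (auto simp: rate_nonneg)
  then show ?thesis
    by (simp add: zw power2_eq_square)
qed

end

section \<open>Projections onto regular polygons\<close>

text \<open>
  This is the Fenchel conjugate of \<open>\<parallel>\<cdot>\<parallel>\<^sup>2/2\<close> restricted to \<open>C\<close>. It is convex and \<open>1\<close>-smooth, and its
  gradient is the projection onto \<open>C\<close>.
\<close>

definition half_sq_minus_dist :: "'a::euclidean_space set \<Rightarrow> 'a \<Rightarrow> real" where
  "half_sq_minus_dist C x = ((norm x)\<^sup>2 - (norm (x - closest_point C x))\<^sup>2) / 2"

text \<open>For the lower bound, the projection of \<open>y\<close> competes with that of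
  \<open>x\<close> in the distance to \<open>x\<close>. The upper bound adds the obtuse angle at the
  projection of \<open>y\<close> to the nonnegative square of the difference of the two
  residuals.\<close>

lemma
  assumes C: "convex C" "closed C" "C \<noteq> {}"
  shows half_sq_minus_dist_lower:
      "half_sq_minus_dist C x \<ge> half_sq_minus_dist C y + inner (closest_point C y) (x - y)"
    and half_sq_minus_dist_upper:
      "half_sq_minus_dist C x \<le> half_sq_minus_dist C y + inner (closest_point C y) (x - y)
         + (norm (x - y))\<^sup>2 / 2"
proof -
  let ?P = "closest_point C"
  have inC: "?P x \<in> C" "?P y \<in> C"
    using C by (auto intro: closest_point_in_set)
  have "norm (x - ?P x) \<le> norm (x - ?P y)"
    using closest_point_le[OF C(2) inC(2), of x] by (simp add: dist_norm)
  then have "(norm (x - ?P x))\<^sup>2 \<le> (norm (x - ?P y))\<^sup>2"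
    by (simp add: power_mono)
  then show "half_sq_minus_dist C x \<ge> half_sq_minus_dist C y + inner (?P y) (x - y)"
    unfolding half_sq_minus_dist_def power2_norm_eq_inner
    by (simp add: inner_diff inner_commute field_simps)
  have "inner (y - ?P y) (?P x - ?P y) \<le> 0"
    using closest_point_dot[OF C(1,2) inC(1)] .
  moreover note inner_ge_zero[of "(x - ?P x) - (y - ?P y)"]
  ultimately show "half_sq_minus_dist C x \<le> half_sq_minus_dist C y + inner (?P y) (x - y)
         + (norm (x - y))\<^sup>2 / 2"
    unfolding half_sq_minus_dist_def power2_norm_eq_inner inner_diff_left inner_diff_right
    by (simp add: inner_commute field_simps)
qed

text \<open>The half-space through \<open>c\<close> with normal \<open>x - c\<close> that avoids
  \<open>x\<close> is convex, so testing the generators puts the whole hull into it, and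
  \<open>c\<close> is its point nearest to \<open>x\<close>.\<close>

lemma closest_point_convex_hull_eqI:
  fixes S :: "'a::euclidean_space set"
  assumes "finite S" "c \<in> S" and obtuse: "\<And>s. s \<in> S \<Longrightarrow> inner (x - c) (s - c) \<le> 0"
  shows "closest_point (convex hull S) x = c"
proof -
  have "convex hull S \<subseteq> {s. inner (x - c) s \<le> inner (x - c) c}"
    by (rule hull_minimal) (use obtuse in \<open>auto simp: inner_diff_right convex_halfspace_le\<close>)
  moreover have "dist x c \<le> dist x s" if "inner (x - c) s \<le> inner (x - c) c" for s
  proof -
    have "0 \<le> inner (s - c) (s - c)" by simp
    then have "inner (x - c) (x - c) \<le> inner (x - s) (x - s)"
      using that by (simp add: inner_diff inner_commute algebra_simps)
    then show ?thesis
      by (simp add: dist_norm norm_eq_sqrt_inner)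
  qed
  ultimately have "\<forall>s\<in>convex hull S. dist x c \<le> dist x s" by blast
  moreover have "closed (convex hull S)"
    using \<open>finite S\<close> by (simp add: compact_imp_closed finite_imp_compact_convex_hull)
  ultimately show ?thesis
    using \<open>c \<in> S\<close> by (intro closest_point_unique[symmetric]) (auto simp: hull_inc)
qed

text \<open>The centroid of the vertices is 0 because the roots of unity sum to 0. This makes 0 its
  own projection, hence a stationary point of the cycling function.\<close>

lemma zero_in_hull_scaled_roots_unity:
  assumes "2 \<le> K"
  shows "(0::complex) \<in> convex hull ((*) m ` {u. u ^ K = 1})"
proof -
  let ?U = "{u::complex. u ^ K = 1}"
  have "(\<Sum>u\<in>?U. (1 / real K) *\<^sub>R (m * u)) \<in> convex hull ((*) m ` ?U)"
    using assms by (intro convex_sum)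
      (auto simp: finite_roots_unity card_roots_unity_eq intro: hull_inc)
  also have "(\<Sum>u\<in>?U. (1 / real K) *\<^sub>R (m * u)) = (1 / real K) *\<^sub>R (m * \<Sum>?U)"
    by (simp add: scaleR_sum_right sum_distrib_left)
  also have "\<dots> = 0"
    using assms sum_roots_unity[of K] by simp
  finally show ?thesis .
qed

text \<open>With \<open>u = cis (2 * \<psi>)\<close> the claimed expression is
  \<open>2 * sin \<psi> * (a * sin \<psi> + b * cos \<psi>)\<close>. It vanishes for
  \<open>u = 1\<close>; otherwise \<open>\<psi>\<close> lies between \<open>pi / K\<close> and
  \<open>pi - pi / K\<close>, where the absolute cotangent is largest at the ends. The neighbours of
  1 are thus the worst case.\<close>

lemma cos_sin_roots_unity_ineq:
  assumes "2 \<le> K" "u ^ K = 1" and ab: "\<bar>b\<bar> * cos (pi / K) \<le> a * sin (pi / K)"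
  shows "0 \<le> a * (1 - Re u) + b * Im u"
proof -
  have "u \<in> (\<lambda>k. cis (2 * pi * real k / real K)) ` {..<K}"
    using Complex.bij_betw_roots_unity[of K] assms by (simp add: bij_betw_def)
  then obtain j where j: "j < K" and u: "u = cis (2 * pi * real j / real K)" by blast
  define \<psi> where "\<psi> = pi * real j / real K"
  have Re: "1 - Re u = 2 * (sin \<psi>)\<^sup>2" and Im: "Im u = 2 * sin \<psi> * cos \<psi>"
    using cos_double_sin[of \<psi>] sin_double[of \<psi>] by (simp_all add: u \<psi>_def mult_ac)
  have "0 \<le> a * sin \<psi> + b * cos \<psi>" "0 \<le> sin \<psi>" if "j \<noteq> 0"
  proof -
    have K: "0 < pi / K" "pi / K \<le> pi / 2"
      using \<open>2 \<le> K\<close> by (auto simp: field_simps)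
    have "pi / K \<le> \<psi>"
      using that \<open>2 \<le> K\<close> by (simp add: \<psi>_def divide_simps)
    moreover have "pi * (real j + 1) \<le> pi * real K"
      using j by (intro mult_left_mono) auto
    then have "\<psi> \<le> pi - pi / K"
      using \<open>2 \<le> K\<close> by (simp add: \<psi>_def field_simps)
    ultimately have \<psi>: "pi / K \<le> \<psi>" "\<psi> \<le> pi - pi / K" by auto
    then show "0 \<le> sin \<psi>"
      using K by (intro sin_ge_zero) auto
    have "cos \<psi> \<le> cos (pi / K)" "cos (pi - pi / K) \<le> cos \<psi>"
      using \<psi> K by - (rule cos_monotone_0_pi_le; linarith)+
    then have cos: "\<bar>cos \<psi>\<bar> \<le> cos (pi / K)"
      by simp
    then have "(cos \<psi>)\<^sup>2 \<le> (cos (pi / K))\<^sup>2"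
      by (simp add: abs_le_square_iff[symmetric])
    then have "(sin (pi / K))\<^sup>2 \<le> (sin \<psi>)\<^sup>2"
      by (simp add: sin_squared_eq)
    then have sin: "sin (pi / K) \<le> sin \<psi>"
      using \<open>0 \<le> sin \<psi>\<close> by (rule power2_le_imp_le)
    have "0 < sin (pi / K)"
      using K pi_gt_zero by (intro sin_gt_zero) linarith+
    moreover have "0 \<le> \<bar>b\<bar> * cos (pi / K)"
      using cos by (intro mult_nonneg_nonneg) auto
    ultimately have "0 \<le> a"
      using ab by (smt (verit) mult_neg_pos)
    have "\<bar>b * cos \<psi>\<bar> \<le> \<bar>b\<bar> * cos (pi / K)"
      unfolding abs_mult by (intro mult_left_mono cos) auto
    also have "\<dots> \<le> a * sin \<psi>"
      using ab mult_left_mono[OF sin \<open>0 \<le> a\<close>] by linarith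
    finally show "0 \<le> a * sin \<psi> + b * cos \<psi>" by linarith
  qed
  then have "0 \<le> 2 * sin \<psi> * (a * sin \<psi> + b * cos \<psi>)"
    by (cases "j = 0") (auto simp: \<psi>_def)
  also have "\<dots> = a * (1 - Re u) + b * Im u"
    by (simp add: Re Im power2_eq_square algebra_simps)
  finally show ?thesis .
qed

text \<open>Rotating by \<open>cnj w\<close> reduces every \<open>w\<close> to 1: with
  \<open>u = cnj w * v\<close>, the inner product for the vertex \<open>m * v\<close> is the
  negative of the preceding expression for \<open>a = Re m - (norm m)\<^sup>2\<close> and
  \<open>b = Im m\<close>.\<close>

lemma closest_point_polygon:
  fixes m w :: complex
  assumes K: "2 \<le> K" and w: "w ^ K = 1"
    and m: "\<bar>Im m\<bar> * cos (pi / K) \<le> (Re m - (norm m)\<^sup>2) * sin (pi / K)"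
  shows "closest_point (convex hull ((*) m ` {u. u ^ K = 1})) w = m * w"
proof (rule closest_point_convex_hull_eqI)
  show "finite ((*) m ` {u. u ^ K = 1})"
    using K by (simp add: finite_roots_unity)
  show "m * w \<in> (*) m ` {u. u ^ K = 1}"
    using w by blast
  fix s assume "s \<in> (*) m ` {u. u ^ K = 1}"
  then obtain v where s: "s = m * v" and v: "v ^ K = 1" by auto
  have "norm w = 1"
    using K w power_eq_1_iff[of w K] by auto
  then have cw: "cnj w * w = 1"
    by (simp add: complex_norm_square[symmetric] mult.commute)
  have "(cnj w * v) ^ K = 1"
    using w v by (simp add: power_mult_distrib flip: complex_cnj_power)
  then have "0 \<le> (Re m - (norm m)\<^sup>2) * (1 - Re (cnj w * v)) + Im m * Im (cnj w * v)"
    using K m by (intro cos_sin_roots_unity_ineq)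
  also have "\<dots> = - Re ((m - of_real ((norm m)\<^sup>2)) * (cnj w * v - 1))"
    by (simp add: algebra_simps)
  also have "(m - of_real ((norm m)\<^sup>2)) * (cnj w * v - 1) = cnj (1 - m) * m * (cnj w * v - cnj w * w)"
    unfolding cw complex_norm_square by (simp add: algebra_simps)
  also have "Re \<dots> = inner (w - m * w) (s - m * w)"
  proof -
    have "inner (w - m * w) (s - m * w) = Re (cnj (w - m * w) * (s - m * w))"
      by (simp add: inner_complex_def algebra_simps)
    also have "cnj (w - m * w) * (s - m * w) = cnj (1 - m) * m * (cnj w * v - cnj w * w)"
      by (simp add: s algebra_simps)
    finally show ?thesis by simp
  qed
  finally show "inner (w - m * w) (s - m * w) \<le> 0" by simp
qed

section \<open>A function of the class with a cycle\<close>

text \<open>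
  The orbit \<open>w\<^sup>t\<close> belongs to \<open>\<mu>\<parallel>\<cdot>\<parallel>\<^sup>2/2 + (L - \<mu>) h\<close>, where \<open>h\<close> is \<^const>\<open>half_sq_minus_dist\<close> for the
  polygon with vertices \<open>m u\<close>, \<open>u\<^sup>K = 1\<close>.
\<close>

lemma rate_ge_1_if_cycle:
  assumes rate: "has_asymptotic_rate \<gamma> \<beta> (smooth_strongly_convex \<mu> L) \<rho>"
    and muL: "0 \<le> \<mu>" "\<mu> \<le> L" and K: "2 \<le> K" and w: "w ^ K = 1"
    and m: "\<bar>Im m\<bar> * cos (pi / K) \<le> (Re m - (norm m)\<^sup>2) * sin (pi / K)"
    and cycle: "w\<^sup>2 = w - \<gamma> *\<^sub>R ((of_real \<mu> + (L - \<mu>) *\<^sub>R m) * w) + \<beta> *\<^sub>R (w - 1)"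
  shows "1 \<le> \<rho>"
proof (rule field_le_epsilon)
  fix \<epsilon> :: real assume "\<epsilon> > 0"
  define C where "C = convex hull ((*) m ` {u. u ^ K = 1})"
  define F where "F x = \<mu> / 2 * (norm x)\<^sup>2 + (L - \<mu>) * half_sq_minus_dist C x" for x
  define G where "G x = \<mu> *\<^sub>R x + (L - \<mu>) *\<^sub>R closest_point C x" for x
  have "0 \<in> C"
    unfolding C_def using K by (rule zero_in_hull_scaled_roots_unity)
  moreover have "compact C"
    unfolding C_def using K by (simp add: finite_imp_compact_convex_hull finite_roots_unity)
  moreover have "convex C"
    by (simp add: C_def)
  ultimately have C: "convex C" "closed C" "C \<noteq> {}" "0 \<in> C"
    by (auto intro: compact_imp_closed)
  have cont: "continuous_on UNIV G"
    unfolding G_def using C by (intro continuous_intros continuous_on_closest_point)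
  have "G 0 = 0"
    using C by (simp add: G_def closest_point_self)
  have sq: "\<mu> / 2 * (norm x)\<^sup>2 = \<mu> / 2 * (norm y)\<^sup>2 + inner (\<mu> *\<^sub>R y) (x - y) + \<mu> / 2 * (norm (x - y))\<^sup>2"
    for x y :: complex
    by (simp add: power2_norm_eq_inner inner_diff algebra_simps inner_commute)
  have ub: "F x \<le> F y + inner (G y) (x - y) + L / 2 * (norm (x - y))\<^sup>2" for x y
    using mult_left_mono[OF half_sq_minus_dist_upper[OF C(1-3), of x y], of "L - \<mu>"] muL sq[of x y]
    by (simp add: F_def G_def inner_add_left algebra_simps diff_divide_distrib)
  have lb: "F x \<ge> F y + inner (G y) (x - y) + \<mu> / 2 * (norm (x - y))\<^sup>2" for x y
    using mult_left_mono[OF half_sq_minus_dist_lower[OF C(1-3), of y x], of "L - \<mu>"] muL sq[of x y]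
    by (simp add: F_def G_def inner_add_left algebra_simps)
  \<comment> \<open>All powers of \<open>w\<close> are \<open>K\<close>-th roots of unity, so the
    gradient multiplies the whole orbit by one complex number, and \<open>cycle\<close> times
    \<open>w ^ t\<close> is the recurrence.\<close>
  have G_w: "G (w ^ t) = (of_real \<mu> + (L - \<mu>) *\<^sub>R m) * w ^ t" for t
  proof -
    have "closest_point C (w ^ t) = m * w ^ t"
      unfolding C_def using K m w
      by (intro closest_point_polygon) (auto simp flip: power_mult simp: mult.commute[of t] power_mult)
    then show ?thesis
      by (simp add: G_def scaleR_conv_of_real algebra_simps)
  qed
  have "w ^ Suc (Suc t) = w ^ Suc t - \<gamma> *\<^sub>R G (w ^ Suc t) + \<beta> *\<^sub>R (w ^ Suc t - w ^ t)" for t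
  proof -
    have "w ^ Suc (Suc t) = w ^ t * w\<^sup>2"
      by (simp add: power2_eq_square)
    also have "\<dots> = w ^ Suc t - \<gamma> *\<^sub>R G (w ^ Suc t) + \<beta> *\<^sub>R (w ^ Suc t - w ^ t)"
      unfolding cycle G_w by (simp add: scaleR_conv_of_real algebra_simps)
    finally show ?thesis .
  qed
  from rate_bounds_complex_orbit[OF rate \<open>\<epsilon> > 0\<close> muL(1) cont \<open>G 0 = 0\<close> ub lb, of "\<lambda>t. w ^ t", OF this]
  obtain T0 where T0: "\<forall>T\<ge>T0. norm (w ^ T)
      \<le> (\<rho> + \<epsilon>) ^ T * sqrt ((norm (w ^ 0))\<^sup>2 + (norm (w ^ 1))\<^sup>2)"
    by blast
  have "0 \<le> \<rho> + \<epsilon>"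
    using rate \<open>\<epsilon> > 0\<close> by (simp add: has_asymptotic_rate_def)
  then have "norm w \<le> \<rho> + \<epsilon>"
    using T0[unfolded norm_power, rule_format] by (rule le_if_power_le_const_mult_power)
  then show "1 \<le> \<rho> + \<epsilon>"
    using K w power_eq_1_iff[of w K] by auto
qed

section \<open>Choice of the polygon and final estimates\<close>

text \<open>The angle is fitted to a target \<open>x\<close> up to a factor 4. The exception
  \<open>K = 3\<close> covers large \<open>x\<close>, as \<open>1 - cos\<close> never exceeds
  2.\<close>

lemma ex_polygon_angle:
  fixes x :: real
  assumes "0 < x"
  shows "\<exists>K\<ge>3. 1 - cos (2 * pi / real K) \<le> x \<and> (K = 3 \<or> x \<le> 4 * (1 - cos (2 * pi / real K)))"
proof -
  \<comment> \<open>Doubling \<open>K\<close> divides \<open>1 - cos (2 \<pi> / K)\<close> by at most \<open>4\<close>, so only \<open>K = 3 \<cdot> 2\<^sup>n\<close> are needed.\<close>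
  define \<theta> where "\<theta> n = 2 * pi / real (3 * 2 ^ n)" for n :: nat
  have "(\<lambda>n. 2 * pi / 3 * (1 / 2) ^ n) \<longlonglongrightarrow> 2 * pi / 3 * 0"
    by (intro tendsto_mult tendsto_const LIMSEQ_power_zero) simp
  then have "\<theta> \<longlonglongrightarrow> 0"
    by (simp add: \<theta>_def[abs_def] power_divide)
  then have "(\<lambda>n. 1 - cos (\<theta> n)) \<longlonglongrightarrow> 1 - cos 0"
    by (intro tendsto_intros)
  then have "\<forall>\<^sub>F n in sequentially. 1 - cos (\<theta> n) < x"
    using assms by (intro order_tendstoD) auto
  then have ex: "\<exists>n. 1 - cos (\<theta> n) \<le> x"
    using eventually_happens' less_imp_le by (metis (mono_tags, lifting) sequentially_bot)
  define n where "n = (LEAST n. 1 - cos (\<theta> n) \<le> x)"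
  have n: "1 - cos (\<theta> n) \<le> x"
    unfolding n_def using ex by (rule LeastI_ex)
  have "n = 0 \<or> x \<le> 4 * (1 - cos (\<theta> n))"
  proof (cases n)
    case (Suc k)
    then have "\<not> 1 - cos (\<theta> k) \<le> x"
      using not_less_Least[of k "\<lambda>n. 1 - cos (\<theta> n) \<le> x"] by (simp add: n_def)
    moreover have "\<theta> k = 2 * \<theta> n"
      by (simp add: \<theta>_def Suc)
    then have "1 - cos (\<theta> k) = (1 - cos (\<theta> n)) * (2 * (1 + cos (\<theta> n)))"
      using cos_double_cos[of "\<theta> n"] by (simp add: power2_eq_square algebra_simps)
    moreover have "(1 - cos (\<theta> n)) * (2 * (1 + cos (\<theta> n))) \<le> (1 - cos (\<theta> n)) * 4"
      by (intro mult_left_mono) auto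
    ultimately show ?thesis by linarith
  qed simp
  moreover have "3 \<le> 3 * (2::nat) ^ n" by simp
  ultimately show ?thesis
    using n unfolding \<theta>_def by (intro exI[of _ "3 * 2 ^ n"]) auto
qed

lemma asymptotic_rate_lower_bound:
  assumes rate: "has_asymptotic_rate \<gamma> \<beta> (smooth_strongly_convex \<mu> L) \<rho>"
    and muL: "0 < \<mu>" "\<mu> < L"
  shows "(1 - 100 * (\<mu> / L)) / (1 + 100 * (\<mu> / L)) \<le> \<rho>"
proof (rule ccontr)
  assume less: "\<not> ?thesis"
  define \<kappa> where "\<kappa> = \<mu> / L"
  define \<sigma> where "\<sigma> = 1 - 100 * \<kappa>"
  define \<Gamma> where "\<Gamma> = \<gamma> * L"
  define \<delta> where "\<delta> = 1 - \<beta>"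
  have "0 \<le> \<rho>"
    using rate by (simp add: has_asymptotic_rate_def)
  have \<kappa>: "0 < \<kappa>" "\<kappa> < 1" and \<mu>: "\<mu> = \<kappa> * L"
    using muL by (auto simp: \<kappa>_def)
  have \<rho>: "\<rho> < \<sigma> / (1 + 100 * \<kappa>)"
    using less by (simp add: \<kappa>_def \<sigma>_def)
  \<comment> \<open>As \<open>\<rho>\<close> is nonnegative, a violated bound has a positive
    numerator. Then \<open>\<sigma>\<close> exceeds the quotient, and it replaces the quotient below
    because \<open>1 - \<sigma>\<close> is an exact multiple of \<open>\<kappa>\<close>.\<close>
  then have "0 < \<sigma> / (1 + 100 * \<kappa>)"
    using \<open>0 \<le> \<rho>\<close> by linarith
  then have "0 < \<sigma>"
    using \<kappa> by (simp add: zero_less_divide_iff)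
  then have "\<sigma> / (1 + 100 * \<kappa>) \<le> \<sigma>"
    using \<kappa> by (simp add: divide_le_eq)
  with \<rho> have "\<rho> < \<sigma>" by linarith
  have "\<sigma> < 1"
    using \<kappa> by (simp add: \<sigma>_def)
  have "\<rho>\<^sup>2 \<le> \<sigma>\<^sup>2"
    using \<open>\<rho> < \<sigma>\<close> \<open>0 \<le> \<rho>\<close> by (intro power_mono) auto
  then have \<beta>: "\<beta> \<le> \<sigma> * \<sigma>"
    using abs_momentum_le[OF rate] muL by (simp add: power2_eq_square)
  moreover have "\<sigma> * \<sigma> < 1"
    using \<open>0 < \<sigma>\<close> \<open>\<sigma> < 1\<close> mult_strict_mono[of \<sigma> 1 \<sigma> 1] by simp
  ultimately have "0 < \<delta>"
    by (simp add: \<delta>_def)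
  \<comment> \<open>At \<open>s = 1\<close> the two polynomials collapse to
    \<open>\<gamma> * lam\<close> and \<open>2 * (1 + \<beta>) - \<gamma> * lam\<close>.\<close>
  have "0 < \<gamma> * \<mu>"
    using characteristic_polynomial_pos(1)[OF rate, of 1 \<mu>] muL \<open>\<rho> < \<sigma>\<close> \<open>\<sigma> < 1\<close> by simp
  then have "0 < \<Gamma>"
    using muL by (simp add: \<Gamma>_def zero_less_mult_iff)
  have \<Gamma>_ub: "\<Gamma> < 2 * (2 - \<delta>)"
    using characteristic_polynomial_pos(2)[OF rate, of 1 L] muL \<open>\<rho> < \<sigma>\<close> \<open>\<sigma> < 1\<close>
    by (simp add: \<Gamma>_def \<delta>_def)
  \<comment> \<open>At \<open>s = \<sigma>\<close> the factor
    \<open>1 - \<sigma> = 100 * \<kappa>\<close> cancels the \<open>\<kappa>\<close> next to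
    \<open>\<Gamma>\<close>. Together with \<open>\<beta> \<le> \<sigma> * \<sigma>\<close> this
    bounds both \<open>\<kappa>\<close> and \<open>\<delta>\<close> by small multiples of
    \<open>\<Gamma>\<close>.\<close>
  have "\<sigma>\<^sup>2 - (1 + \<beta> - \<Gamma> * \<kappa>) * \<sigma> + \<beta> > 0"
    using characteristic_polynomial_pos(1)[OF rate, of \<sigma> \<mu>] muL \<kappa> \<open>\<rho> < \<sigma>\<close>
    by (simp add: \<Gamma>_def \<mu> mult_ac)
  then have "(1 - \<sigma>) * (\<sigma> - \<beta>) < \<Gamma> * \<kappa> * \<sigma>"
    by (simp add: power2_eq_square algebra_simps)
  then have "\<kappa> * (100 * (\<sigma> - \<beta>)) < \<kappa> * (\<Gamma> * \<sigma>)"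
    by (simp add: \<sigma>_def algebra_simps)
  then have lt: "100 * (\<sigma> - \<beta>) < \<Gamma> * \<sigma>"
    using \<kappa> by (simp only: mult_less_cancel_left_pos)
  have "\<sigma> * (100 * (100 * \<kappa>)) = 100 * (\<sigma> - \<sigma> * \<sigma>)"
    by (simp add: \<sigma>_def algebra_simps)
  also have "\<dots> < \<sigma> * \<Gamma>"
    using lt \<beta> by (simp add: mult.commute)
  finally have \<kappa>_lt: "10000 * \<kappa> < \<Gamma>"
    using \<open>0 < \<sigma>\<close> by (simp only: mult_less_cancel_left_pos)
  have "\<Gamma> * \<sigma> \<le> \<Gamma>"
    using \<open>0 < \<Gamma>\<close> \<open>\<sigma> < 1\<close> by simp
  then have \<delta>_lt: "50 * \<delta> < \<Gamma>"
    using lt \<kappa>_lt by (simp add: \<delta>_def \<sigma>_def)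
  have \<kappa>_small: "\<kappa> < 1 / 2500" and "\<delta> < 1"
    using \<kappa>_lt \<delta>_lt \<Gamma>_ub \<open>0 < \<delta>\<close> by auto
  \<comment> \<open>The target is chosen so that \<open>r\<close>, defined below, is at most 7/8;
    the factor 4 then gives at least 7/32. For \<open>K = 3\<close> the bound on
    \<open>\<Gamma>\<close> even gives 3/4.\<close>
  obtain K where K: "K \<ge> 3" "1 - cos (2 * pi / real K) \<le> 7 / 8 * \<Gamma> / (2 - \<delta>)"
      "K = 3 \<or> 7 / 8 * \<Gamma> / (2 - \<delta>) \<le> 4 * (1 - cos (2 * pi / real K))"
    using ex_polygon_angle[of "7 / 8 * \<Gamma> / (2 - \<delta>)"] \<open>0 < \<Gamma>\<close> \<open>\<delta> < 1\<close> by auto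
  define \<theta> where "\<theta> = 2 * pi / real K"
  define w where "w = cis \<theta>"
  \<comment> \<open>\<open>Complex r (- q)\<close> is the number \<open>R\<close> of the
    introduction, and \<open>m\<close> is \<open>(R - \<kappa>) / (1 - \<kappa>)\<close>.\<close>
  define r where "r = (2 - \<delta>) * (1 - cos \<theta>) / \<Gamma>"
  define q where "q = \<delta> * sin \<theta> / \<Gamma>"
  define m where "m = Complex ((r - \<kappa>) / (1 - \<kappa>)) (- q / (1 - \<kappa>))"
  have r_ub: "r \<le> 7 / 8"
    using K(2) \<open>0 < \<Gamma>\<close> \<open>\<delta> < 1\<close> by (simp add: r_def \<theta>_def field_simps)
  have r_lb: "7 / 32 \<le> r"
    using K(3)
  proof
    assume "K = 3"
    then have "cos \<theta> = - 1 / 2"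
      using cos_120 by (simp add: \<theta>_def)
    then show ?thesis
      using \<open>0 < \<Gamma>\<close> \<Gamma>_ub unfolding r_def by (simp only:) (simp add: field_simps)
  next
    assume "7 / 8 * \<Gamma> / (2 - \<delta>) \<le> 4 * (1 - cos (2 * pi / real K))"
    then show ?thesis
      using \<open>0 < \<Gamma>\<close> \<open>\<delta> < 1\<close> by (simp add: r_def \<theta>_def field_simps)
  qed
  define \<alpha> where "\<alpha> = pi / real K"
  have sin_\<theta>: "sin \<theta> = 2 * sin \<alpha> * cos \<alpha>"
    using sin_double[of \<alpha>] by (simp add: \<theta>_def \<alpha>_def)
  have "0 < \<alpha>" "\<alpha> \<le> pi / 2"
    using K(1) by (auto simp: \<alpha>_def field_simps)
  then have sin_cos: "0 \<le> sin \<alpha>" "0 \<le> cos \<alpha>"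
    by (auto intro!: sin_ge_zero cos_ge_zero)
  have "\<delta> / \<Gamma> \<le> 1 / 50"
    using \<delta>_lt \<open>0 < \<Gamma>\<close> by (simp add: field_simps)
  then have "0 \<le> \<delta> / \<Gamma>" "\<delta> / \<Gamma> \<le> 1 / 50"
    using \<open>0 < \<delta>\<close> \<open>0 < \<Gamma>\<close> by auto
  have "\<bar>q\<bar> \<le> 1 / 50 * 1"
    using \<open>0 \<le> \<delta> / \<Gamma>\<close> \<open>\<delta> / \<Gamma> \<le> 1 / 50\<close> mult_mono[of "\<delta> / \<Gamma>" "1 / 50" "\<bar>sin \<theta>\<bar>" 1]
      \<open>0 < \<delta>\<close> \<open>0 < \<Gamma>\<close>
    by (simp add: q_def abs_mult)
  then have "q\<^sup>2 \<le> (1 / 50)\<^sup>2"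
    by (intro abs_le_square_iff[THEN iffD1]) simp
  moreover have "0 \<le> (r - 7 / 32) * (7 / 8 - r)"
    using r_lb r_ub by (intro mult_nonneg_nonneg) auto
  moreover have "\<kappa> * (1 - r) \<le> \<kappa> * 1"
    using \<kappa> r_lb by (intro mult_left_mono) auto
  \<comment> \<open>This certifies the minimum 7/64 of the concave \<open>r * (1 - r)\<close> on the
    interval from 7/32 to 7/8. The errors \<open>\<kappa>\<close> and \<open>q\<^sup>2\<close>, each
    at most 1/2500, leave more than 1/25.\<close>
  moreover have "(r - \<kappa>) * (1 - r)
      = (r - 7 / 32) * (7 / 8 - r) + 49 / 256 - 3 / 32 * r - \<kappa> * (1 - r)"
    by (simp add: field_simps)
  moreover have "(1 / 50)\<^sup>2 = (1 / 2500 :: real)"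
    by (simp add: power2_eq_square)
  ultimately have "1 / 25 \<le> (r - \<kappa>) * (1 - r) - q\<^sup>2"
    using r_ub \<kappa>_small by linarith
  moreover have "1 / 25 * (1 - \<kappa>) \<le> 1 / 25"
    using \<kappa> by simp
  ultimately have margin: "1 / 25 * (1 - \<kappa>) \<le> (r - \<kappa>) * (1 - r) - q\<^sup>2"
    by (rule order_trans[rotated])
  \<comment> \<open>The double-angle formula for \<open>sin \<theta>\<close> supplies the factor
    \<open>sin \<alpha>\<close> needed on the right, so a fixed margin suffices for every
    \<open>K\<close>.\<close>
  have "\<bar>Im m\<bar> * cos \<alpha> = 2 * (\<delta> / \<Gamma>) * (cos \<alpha> * cos \<alpha>) * sin \<alpha> / (1 - \<kappa>)"
    using \<kappa> sin_cos \<open>0 < \<delta>\<close> \<open>0 < \<Gamma>\<close> by (simp add: m_def q_def sin_\<theta> abs_mult abs_divide abs_of_pos)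
  also have "\<dots> \<le> 2 * (1 / 50) * (1 * 1) * sin \<alpha> / (1 - \<kappa>)"
    using \<kappa> sin_cos \<open>\<delta> / \<Gamma> \<le> 1 / 50\<close> \<open>0 \<le> \<delta> / \<Gamma>\<close>
    by (intro divide_right_mono mult_right_mono mult_mono) auto
  also have "\<dots> = 1 / 25 * (1 - \<kappa>) / (1 - \<kappa>)\<^sup>2 * sin \<alpha>"
    using \<kappa> by (simp add: power2_eq_square)
  also have "\<dots> \<le> ((r - \<kappa>) * (1 - r) - q\<^sup>2) / (1 - \<kappa>)\<^sup>2 * sin \<alpha>"
    using margin sin_cos by (intro mult_right_mono divide_right_mono) auto
  also have "((r - \<kappa>) * (1 - r) - q\<^sup>2) / (1 - \<kappa>)\<^sup>2 = Re m - (norm m)\<^sup>2"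
  proof -
    have "Re m - (norm m)\<^sup>2 = (r - \<kappa>) / (1 - \<kappa>) - ((r - \<kappa>)\<^sup>2 + q\<^sup>2) / (1 - \<kappa>)\<^sup>2"
      by (simp add: m_def cmod_power2 power_divide add_divide_distrib)
    also have "(r - \<kappa>) / (1 - \<kappa>) = (r - \<kappa>) * (1 - \<kappa>) / (1 - \<kappa>)\<^sup>2"
      using \<kappa> by (simp add: power2_eq_square)
    finally show ?thesis
      by (simp add: power2_eq_square algebra_simps flip: diff_divide_distrib)
  qed
  finally have obtuse: "\<bar>Im m\<bar> * cos (pi / K) \<le> (Re m - (norm m)\<^sup>2) * sin (pi / K)"
    by (simp add: \<alpha>_def)
  have "of_real \<mu> + (L - \<mu>) *\<^sub>R m = L *\<^sub>R Complex r (- q)"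
  proof -
    have "(1 - \<kappa>) *\<^sub>R m = Complex (r - \<kappa>) (- q)"
      using \<kappa> by (simp add: complex_eq_iff m_def)
    moreover have "(L - \<mu>) *\<^sub>R m = L *\<^sub>R (1 - \<kappa>) *\<^sub>R m"
      by (simp add: \<mu> algebra_simps)
    ultimately have "(L - \<mu>) *\<^sub>R m = L *\<^sub>R Complex (r - \<kappa>) (- q)"
      by simp
    then show ?thesis
      by (simp add: complex_eq_iff \<mu> algebra_simps)
  qed
  moreover have "\<gamma> *\<^sub>R L *\<^sub>R Complex r (- q) = of_real (1 + \<beta>) - w - of_real \<beta> * cnj w"
  proof -
    have "\<Gamma> * r = (2 - \<delta>) * (1 - cos \<theta>)" "\<Gamma> * q = \<delta> * sin \<theta>"
      using \<open>0 < \<Gamma>\<close> by (simp_all add: r_def q_def)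
    then show ?thesis
      by (simp add: complex_eq_iff w_def \<delta>_def \<Gamma>_def algebra_simps)
  qed
  ultimately have "\<gamma> *\<^sub>R ((of_real \<mu> + (L - \<mu>) *\<^sub>R m) * w)
      = (of_real (1 + \<beta>) - w - of_real \<beta> * cnj w) * w"
    by (metis mult_scaleR_left)
  also have "\<dots> = of_real (1 + \<beta>) * w - w\<^sup>2 - of_real \<beta> * (cnj w * w)"
    by (simp add: power2_eq_square algebra_simps)
  also have "cnj w * w = 1"
    by (simp add: w_def cis_cnj cis_mult)
  finally have "w\<^sup>2 = w - \<gamma> *\<^sub>R ((of_real \<mu> + (L - \<mu>) *\<^sub>R m) * w) + \<beta> *\<^sub>R (w - 1)"
    by (simp add: scaleR_conv_of_real algebra_simps)
  moreover have "w ^ K = 1"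
    unfolding w_def \<theta>_def Complex.DeMoivre using K(1) by simp
  ultimately have "1 \<le> \<rho>"
    using rate_ge_1_if_cycle[OF rate _ _ _ _ obtuse] muL K(1) by simp
  then show False
    using \<open>\<rho> < \<sigma>\<close> \<open>\<sigma> < 1\<close> by linarith
qed

theorem corollary3p7:
  shows "\<exists>C::real. C > 0 \<and>
    (\<forall>\<mu> L \<gamma> \<beta> :: real. 0 < \<mu> \<and> \<mu> < L \<longrightarrow>
       worst_case_rate \<gamma> \<beta> (smooth_strongly_convex \<mu> L)
         \<ge> ereal ((1 - C * (\<mu> / L)) / (1 + C * (\<mu> / L))))"
  \<comment> \<open>Bounding each admissible rate also covers the case of no rate, where the infimum
    is infinite.\<close>
  unfolding worst_case_rate_def
  using asymptotic_rate_lower_bound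
  by (intro exI[of _ 100] conjI allI impI INF_greatest) auto

end
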